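(* Fix $0<q<1$. The $q$-entropy $\mu\mapsto H_q(\mu)$ is an upper semi-continuous function on $\mathcal{M}_{\mathrm{inv}}(\sigma)$ (with respect to the weak$^*$ topology).
   Context: $\Omega=\{1,\dots,d\}^{\mathbb N}$, $\sigma:\Omega\to\Omega$ is the one-sided shift, $\mathcal{M}_{\mathrm{inv}}(\sigma)$ is the set of $\sigma$-invariant Borel probability measures on $\Omega$, and $\mathcal{C}^+$ is the set of continuous strictly positive functions on $\Omega$. For $x\in\Omega$ and $a\in\{1,\dots,d\}$, $ax$ is the sequence obtained by placing $a$ in front of $x$. For $0<q<1$ and $u>0$, $\log_q(u)=\frac{1}{1-q}(u^{1-q}-1)$. For $\mu\in\mathcal{M}_{\mathrm{inv}}(\sigma)$ the $q$-entropy is $$H_q(\mu)=\inf_{u\in\mathcal{C}^+}\int\log_q\Big(\frac{\sum_{a=1}^du(ax)}{u(x)}\Big)\,d\mu(x).$$ *)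

theory Defs
  imports "HOL-Probability.Probability"
begin

text \<open>
  The full shift on the symbols \<open>{1..d}\<close> is a subset of the type \<^typ>\<open>nat \<Rightarrow> nat\<close>,
  whose topology is the product of the discrete topologies. Subsets of it carry the subspace
  topology and the induced Borel sigma-algebra.
\<close>

definition full_shift :: "nat \<Rightarrow> (nat \<Rightarrow> nat) set" where
  "full_shift d = {x. \<forall>n. x n \<in> {1..d}}"

definition shift :: "(nat \<Rightarrow> nat) \<Rightarrow> nat \<Rightarrow> nat" where
  "shift x = (\<lambda>n. x (Suc n))"

definition prepend :: "nat \<Rightarrow> (nat \<Rightarrow> nat) \<Rightarrow> nat \<Rightarrow> nat" where
  "prepend a x = case_nat a x"

definition borel_probs :: "nat \<Rightarrow> (nat \<Rightarrow> nat) measure set" where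
  "borel_probs d = {\<mu>. prob_space \<mu> \<and> sets \<mu> = sets (restrict_space borel (full_shift d))}"

definition invariant_probs :: "nat \<Rightarrow> (nat \<Rightarrow> nat) measure set" where
  "invariant_probs d =
    {\<mu> \<in> borel_probs d. \<forall>A \<in> sets \<mu>. emeasure \<mu> (shift -` A \<inter> space \<mu>) = emeasure \<mu> A}"

text \<open>
  The coarsest topology on the Borel probability measures for which \<open>\<mu> \<mapsto> \<integral>f d\<mu>\<close> is continuous
  for every continuous real function \<open>f\<close> on the full shift.
\<close>

definition weak_star_topology :: "nat \<Rightarrow> (nat \<Rightarrow> nat) measure topology" where
  "weak_star_topology d = topology_generated_by
    {{\<mu> \<in> borel_probs d. (\<integral>x. f x \<partial>\<mu>) \<in> U} | f U.
      continuous_on (full_shift d) (f :: (nat \<Rightarrow> nat) \<Rightarrow> real) \<and> open U}"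

definition upper_semicontinuous_map :: "'a topology \<Rightarrow> ('a \<Rightarrow> real) \<Rightarrow> bool" where
  "upper_semicontinuous_map X f \<longleftrightarrow> (\<forall>c. openin X {x \<in> topspace X. f x < c})"

definition log_q :: "real \<Rightarrow> real \<Rightarrow> real" where
  "log_q q u = 1 / (1 - q) * (u powr (1 - q) - 1)"

definition pos_continuous :: "nat \<Rightarrow> ((nat \<Rightarrow> nat) \<Rightarrow> real) set" where
  "pos_continuous d = {u. continuous_on (full_shift d) u \<and> (\<forall>x \<in> full_shift d. 0 < u x)}"

text \<open>
  For \<open>0 < q < 1\<close> the integrands are continuous on a compact space and at least \<open>- 1 / (1 - q)\<close>,
  so for \<open>\<mu> \<in> borel_probs d\<close> the integrals exist, the infimum is that of a nonempty set
  bounded below, and a real-valued infimum loses nothing.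
\<close>

definition q_entropy :: "nat \<Rightarrow> real \<Rightarrow> (nat \<Rightarrow> nat) measure \<Rightarrow> real" where
  "q_entropy d q \<mu> = (INF u \<in> pos_continuous d.
     \<integral>x. log_q q ((\<Sum>a=1..d. u (prepend a x)) / u x) \<partial>\<mu>)"

end

theory Submission
  imports Defs
begin

text \<open>
  The \<open>q\<close>-entropy is an infimum of the maps \<open>\<mu> \<mapsto> \<integral>f d\<mu>\<close> with \<open>f\<close> continuous, and each of these
  is weak-star continuous. Hence each strict sublevel set is a union of open sets.
\<close>

lemma continuous_on_prepend: "continuous_on S (prepend a)"
proof (rule continuous_on_coordinatewise_then_product)
  fix i
  have "continuous_on S (\<lambda>x :: nat \<Rightarrow> nat. x j)" for j
    by (rule continuous_on_subset[OF continuous_on_product_coordinates subset_UNIV])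
  \<comment> \<open>Coordinate 0 of \<open>prepend a x\<close> is the constant \<open>a\<close>;
    coordinate \<open>Suc j\<close> is the projection to coordinate \<open>j\<close>.\<close>
  then show "continuous_on S (\<lambda>x. prepend a x i)"
    by (cases i) (simp_all add: prepend_def)
qed

lemma prepend_in_full_shift: "\<lbrakk>a \<in> {1..d}; x \<in> full_shift d\<rbrakk> \<Longrightarrow> prepend a x \<in> full_shift d"
  by (auto simp: full_shift_def prepend_def split: nat.split)

lemma continuous_on_entropy_integrand:
  assumes "1 \<le> d" and "u \<in> pos_continuous d"
  shows "continuous_on (full_shift d) (\<lambda>x. log_q q ((\<Sum>a=1..d. u (prepend a x)) / u x))"
proof -
  have u: "continuous_on (full_shift d) u" and pos: "\<And>x. x \<in> full_shift d \<Longrightarrow> 0 < u x"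
    using assms by (auto simp: pos_continuous_def)
  have "continuous_on (full_shift d) (\<lambda>x. u (prepend a x))" if "a \<in> {1..d}" for a
    by (rule continuous_on_compose2[OF u continuous_on_prepend])
      (auto intro: prepend_in_full_shift[OF that])
  then have sum: "continuous_on (full_shift d) (\<lambda>x. \<Sum>a=1..d. u (prepend a x))"
    by (intro continuous_on_sum)
  have "continuous_on (full_shift d) (\<lambda>x. (\<Sum>a=1..d. u (prepend a x)) / u x)"
    by (rule continuous_on_divide[OF sum u]) (auto dest: pos)
  \<comment> \<open>\<open>continuous_on_powr\<close> asks for a base that never vanishes. With
    \<open>1 \<le> d\<close> the sum has at least one term, and all its terms are positive.\<close>
  moreover have "\<forall>x \<in> full_shift d. (\<Sum>a=1..d. u (prepend a x)) / u x \<noteq> 0"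
  proof
    fix x assume x: "x \<in> full_shift d"
    have "0 < (\<Sum>a=1..d. u (prepend a x))"
      using assms(1) by (intro sum_pos pos prepend_in_full_shift x) auto
    with pos[OF x] show "(\<Sum>a=1..d. u (prepend a x)) / u x \<noteq> 0"
      by simp
  qed
  ultimately have "continuous_on (full_shift d)
      (\<lambda>x. ((\<Sum>a=1..d. u (prepend a x)) / u x) powr (1 - q))"
    by (rule continuous_on_powr[OF _ continuous_on_const])
  then show ?thesis
    unfolding log_q_def
    by (rule continuous_on_mult_left[OF continuous_on_diff[OF _ continuous_on_const]])
qed

text \<open>Because \<open>powr\<close> is nonnegative at every real base, \<open>log_q\<close> has
  a pointwise lower bound, which survives averaging over a probability. The bound does not depend on
  \<open>g\<close>, so it serves all \<open>u\<close> in the infimum at once.\<close>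

lemma (in prob_space) integral_log_q_ge:
  assumes "q < 1"
  shows "- 1 / (1 - q) \<le> (\<integral>x. log_q q (g x) \<partial>M)"
proof (cases "integrable M (\<lambda>x. log_q q (g x))")
  case True
  have "- 1 / (1 - q) \<le> log_q q t" for t
  proof -
    have "- 1 / (1 - q) = 1 / (1 - q) * (- 1)"
      by simp
    also have "\<dots> \<le> log_q q t"
      unfolding log_q_def using assms by (intro mult_left_mono) auto
    finally show ?thesis .
  qed
  then show ?thesis
    by (intro integral_ge_const[OF True] always_eventually allI)
next
  \<comment> \<open>Here the integral takes its default value 0, which still lies above the negative
    bound.\<close>
  case False
  with assms show ?thesis
    by (simp add: not_integrable_integral_eq)
qed

text \<open>This is what turns a sublevel set into a union over \<open>u\<close>. The reals are only
  conditionally complete, so extracting a witness from the infimum needs a nonempty family, shown by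
  the constant function 1, and a lower bound, given by \<open>integral_log_q_ge\<close>.\<close>

lemma q_entropy_less_iff:
  assumes "q < 1" and "\<mu> \<in> borel_probs d"
  shows "q_entropy d q \<mu> < c \<longleftrightarrow>
    (\<exists>u \<in> pos_continuous d. (\<integral>x. log_q q ((\<Sum>a=1..d. u (prepend a x)) / u x) \<partial>\<mu>) < c)"
  unfolding q_entropy_def
proof (rule cINF_less_iff)
  have "(\<lambda>_. 1) \<in> pos_continuous d"
    by (simp add: pos_continuous_def)
  then show "pos_continuous d \<noteq> {}"
    by blast
  interpret prob_space \<mu>
    using assms by (simp add: borel_probs_def)
  show "bdd_below ((\<lambda>u. \<integral>x. log_q q ((\<Sum>a=1..d. u (prepend a x)) / u x) \<partial>\<mu>) ` pos_continuous d)"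
    by (rule bdd_belowI2) (rule integral_log_q_ge[OF assms(1)])
qed

lemma openin_weak_star_integral:
  fixes f :: "(nat \<Rightarrow> nat) \<Rightarrow> real"
  assumes "continuous_on (full_shift d) f" and "open U"
  shows "openin (weak_star_topology d) {\<mu> \<in> borel_probs d. (\<integral>x. f x \<partial>\<mu>) \<in> U}"
  unfolding weak_star_topology_def
  by (rule topology_generated_by_Basis, rule CollectI, intro exI conjI) (rule refl assms)+

lemma topspace_weak_star_topology: "topspace (weak_star_topology d) = borel_probs d"
proof
  show "topspace (weak_star_topology d) \<subseteq> borel_probs d"
    by (auto simp: weak_star_topology_def)
  show "borel_probs d \<subseteq> topspace (weak_star_topology d)"
    \<comment> \<open>For the zero function and \<open>U = UNIV\<close> the generating set is all of
      \<open>borel_probs d\<close>.\<close>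
    using openin_subset[OF openin_weak_star_integral[of d "\<lambda>_. 0" UNIV]] by simp
qed

theorem lemma3p6:
  fixes d :: nat and q :: real
  assumes "1 \<le> d" and "0 < q" and "q < 1"
  shows "upper_semicontinuous_map
    (subtopology (weak_star_topology d) (invariant_probs d)) (q_entropy d q)"
  unfolding upper_semicontinuous_map_def
proof
  fix c
  let ?I = "\<lambda>u \<mu>. \<integral>x. log_q q ((\<Sum>a=1..d. u (prepend a x)) / u x) \<partial>\<mu>"
  \<comment> \<open>Writing the inequality as membership in the open half-line gives each piece the
    shape of a generating set of the topology.\<close>
  let ?V = "\<Union>u \<in> pos_continuous d. {\<mu> \<in> borel_probs d. ?I u \<mu> \<in> {..<c}}"
  have "openin (weak_star_topology d) ?V"
  proof (rule openin_Union)
    fix S assume "S \<in> (\<lambda>u. {\<mu> \<in> borel_probs d. ?I u \<mu> \<in> {..<c}}) ` pos_continuous d"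
    then obtain u where u: "u \<in> pos_continuous d" and S: "S = {\<mu> \<in> borel_probs d. ?I u \<mu> \<in> {..<c}}"
      by blast
    show "openin (weak_star_topology d) S"
      unfolding S
      by (rule openin_weak_star_integral[OF continuous_on_entropy_integrand[OF assms(1) u] open_lessThan])
  qed
  \<comment> \<open>Both sides lie in \<open>borel_probs d\<close>, where
    \<open>q_entropy_less_iff\<close> applies; the right side is the trace on the subspace of a set
    open in the whole space.\<close>
  moreover have "{\<mu> \<in> topspace (subtopology (weak_star_topology d) (invariant_probs d)).
      q_entropy d q \<mu> < c} = ?V \<inter> invariant_probs d"
    using q_entropy_less_iff[OF assms(3)] by (auto simp: topspace_weak_star_topology)
  ultimately show "openin (subtopology (weak_star_topology d) (invariant_probs d))
      {\<mu> \<in> topspace (subtopology (weak_star_topology d) (invariant_probs d)). q_entropy d q \<mu> < c}"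
    by (auto simp: openin_subtopology)
qed

end
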